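(* Let $n\ge 2$, let $\Omega_n=\mathbb{R}^{n-1}\times(0,1)=\{x=(x',x_n):\ x'\in\mathbb{R}^{n-1},\ 0<x_n<1\}$, let $f:\mathbb{R}\to\mathbb{R}$ be a locally Lipschitz continuous function and let $u$ be a bounded $C^2(\overline{\Omega_n})$ solution of the equation $$\Delta u+f(u)=0\quad\text{in }\Omega_n.$$ Suppose that, for some constant $c>0$, $u=0$ on $\{x_n=0\}$, $u=c$ on $\{x_n=1\}$, and $0<u<c$ in $\Omega_n$. If $$\forall\,0<x_n<1,\quad 0<\inf_{x'\in\mathbb{R}^{n-1}}u(x',x_n)\le\sup_{x'\in\mathbb{R}^{n-1}}u(x',x_n)<c,$$ or if $$f(c)\le 0\le f(0),$$ then $u$ is a function of $x_n$ only, that is, $u(x_1,\dots,x_n)=\tilde{u}(x_n)$ in $\overline{\Omega_n}$ for some function $\tilde u$ on $[0,1]$, and $\tilde{u}'(x_n)>0$ for all $0<x_n<1$.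
   Context: $C^2(\overline{\Omega_n})$ means that all partial derivatives up to order $2$ exist and are continuous up to the boundary (they are not assumed bounded). *)

theory Defs
  imports "HOL-Analysis.Analysis"
begin

definition partial_deriv :: "'a::euclidean_space \<Rightarrow> ('a \<Rightarrow> real) \<Rightarrow> 'a \<Rightarrow> real" where
  "partial_deriv i u x = deriv (\<lambda>t. u (x + t *\<^sub>R i)) 0"

definition has_partial :: "'a::euclidean_space \<Rightarrow> ('a \<Rightarrow> real) \<Rightarrow> 'a \<Rightarrow> bool" where
  "has_partial i u x \<longleftrightarrow> (\<lambda>t. u (x + t *\<^sub>R i)) differentiable (at (0::real))"

definition laplacian :: "('a::euclidean_space \<Rightarrow> real) \<Rightarrow> 'a \<Rightarrow> real" where
  "laplacian u x = (\<Sum>i\<in>Basis. partial_deriv i (partial_deriv i u) x)"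

definition extends_to_closure :: "'a::euclidean_space set \<Rightarrow> ('a \<Rightarrow> real) \<Rightarrow> bool" where
  "extends_to_closure S g \<longleftrightarrow> (\<exists>h. continuous_on (closure S) h \<and> (\<forall>x\<in>S. h x = g x))"

(* The space C^2(closure S) for an open set S. The derivatives are taken in S only, so the values
   of u outside closure S play no role. No bound on u or on its derivatives is required. *)
definition C2_closure :: "'a::euclidean_space set \<Rightarrow> ('a \<Rightarrow> real) \<Rightarrow> bool" where
  "C2_closure S u \<longleftrightarrow>
     continuous_on (closure S) u \<and>
     (\<forall>i\<in>Basis. (\<forall>x\<in>S. has_partial i u x) \<and> extends_to_closure S (partial_deriv i u)) \<and>
     (\<forall>i\<in>Basis. \<forall>j\<in>Basis. (\<forall>x\<in>S. has_partial j (partial_deriv i u) x) \<and>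
        extends_to_closure S (partial_deriv j (partial_deriv i u)))"

(* R^n is represented as R^(n-1) x R, with n - 1 = CARD('m). Index types are nonempty, so n ranges
   over all integers n >= 2; the last coordinate of x is snd x. *)
definition slab :: "((real ^ 'm) \<times> real) set" where
  "slab = UNIV \<times> {0<..<1}"

end

theory Submission
  imports Defs
begin

text \<open>
  The proof is a sliding argument: \<open>u (x, t) \<le> u (y, t + s)\<close> is shown for all \<open>x\<close>, \<open>y\<close> and all
  \<open>s\<close> in \<open>[0, 1]\<close>, by lowering \<open>s\<close> from \<open>1\<close> to \<open>0\<close>. At \<open>s = 0\<close> the roles of \<open>x\<close> and \<open>y\<close> can
  be exchanged, so \<open>u\<close> depends on \<open>t\<close> only, and for \<open>s > 0\<close> the inequality says that it is nondecreasing
  in \<open>t\<close> (\<open>one_dimensional\<close>). A nondecreasing solution of \<open>v'' + f v = 0\<close> with a critical point would be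
  symmetric about it, which its values at \<open>0\<close>, at \<open>1\<close> and in between exclude (\<open>monotone_profile_deriv_pos\<close>).
  
  The difficulty is that the slab is unbounded, so that an inequality that is strict everywhere need
  not be strict uniformly. The usual remedy extracts limits of translates of \<open>u\<close> by elliptic estimates and
  applies the strong maximum principle to the limit. Here explicit comparison functions take their place.
  
  All comparisons rest on one maximum principle for functions bounded below on a cylinder with compact
  cross section (\<open>cylinder_maximum_principle\<close>). It has three uses.
  
  \<^item> The exponential \<open>exp (\<mu> (t - z)) - 1\<close> is a subsolution of \<open>\<Delta> w = L w\<close>. It spreads a positive
  lower bound from one face of a slab into its interior, uniformly in the unbounded directions
  (\<open>exponential_minorant\<close>). Applied to \<open>u\<close>, it shows that the sign condition on \<open>f 0\<close> implies that
  the infimum of \<open>u\<close> over each slice is positive. Applied to the difference of \<open>u\<close> and a translate, it gives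
  a uniform gap between them away from the upper face (\<open>slides_gap\<close>).
  
  \<^item> After doubling the variable \<open>t\<close>, it gives a Lipschitz bound for \<open>u\<close> in \<open>t\<close>
  (\<open>vertical_lipschitz\<close>), so that the gap survives a small decrease of \<open>s\<close>.
  
  \<^item> In a thin slab it tolerates a zeroth order term of either sign. This settles the strip along the
  upper face, where there is no gap (\<open>slides_open\<close>).
\<close>

section \<open>Second derivatives along lines and the Laplacian\<close>

text \<open>
  The second derivative is taken at \<^term>\<open>0::real\<close> because all the functions concerned are restrictions to
  lines \<open>t \<mapsto> w (x + t *\<^sub>R i)\<close>. A relation, rather than a value computed by \<^const>\<open>deriv\<close>, carries
  the existence of the derivatives with it, and so is preserved by sums and by changes of variables.
\<close>
definition has_second_deriv :: "(real \<Rightarrow> real) \<Rightarrow> real \<Rightarrow> bool" where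
  "has_second_deriv g d \<longleftrightarrow>
     (\<exists>g'. (\<forall>\<^sub>F t in nhds 0. (g has_real_derivative g' t) (at t)) \<and>
           (g' has_real_derivative d) (at 0))"

definition has_laplacian :: "('a::euclidean_space \<Rightarrow> real) \<Rightarrow> 'a \<Rightarrow> real \<Rightarrow> bool" where
  "has_laplacian w x l \<longleftrightarrow>
     (\<exists>D. (\<forall>i\<in>Basis. has_second_deriv (\<lambda>t. w (x + t *\<^sub>R i)) (D i)) \<and> l = sum D Basis)"

lemma has_second_derivI:
  assumes "\<And>t. (g has_real_derivative g' t) (at t)" "(g' has_real_derivative d) (at 0)"
  shows "has_second_deriv g d"
  unfolding has_second_deriv_def using assms by (intro exI[of _ g']) auto

lemma has_second_deriv_add:
  assumes "has_second_deriv g d" "has_second_deriv h e"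
  shows "has_second_deriv (\<lambda>t. g t + h t) (d + e)"
proof -
  obtain g' h' where *: "\<forall>\<^sub>F t in nhds 0. (g has_real_derivative g' t) (at t)"
      "\<forall>\<^sub>F t in nhds 0. (h has_real_derivative h' t) (at t)"
      "(g' has_real_derivative d) (at 0)" "(h' has_real_derivative e) (at 0)"
    using assms unfolding has_second_deriv_def by blast
  show ?thesis
    unfolding has_second_deriv_def
  proof (intro exI conjI)
    show "\<forall>\<^sub>F t in nhds 0. ((\<lambda>t. g t + h t) has_real_derivative g' t + h' t) (at t)"
      using *(1,2) by eventually_elim (rule DERIV_add)
  qed (rule DERIV_add[OF *(3,4)])
qed

lemma has_second_deriv_cmult:
  assumes "has_second_deriv g d"
  shows "has_second_deriv (\<lambda>t. k * g t) (k * d)"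
proof -
  obtain g' where *: "\<forall>\<^sub>F t in nhds 0. (g has_real_derivative g' t) (at t)"
      "(g' has_real_derivative d) (at 0)"
    using assms unfolding has_second_deriv_def by blast
  show ?thesis
    unfolding has_second_deriv_def
  proof (intro exI conjI)
    show "\<forall>\<^sub>F t in nhds 0. ((\<lambda>t. k * g t) has_real_derivative k * g' t) (at t)"
      using *(1) by eventually_elim (rule DERIV_cmult)
  qed (rule DERIV_cmult[OF *(2)])
qed

lemma has_second_deriv_const: "has_second_deriv (\<lambda>t. k) 0"
  by (rule has_second_derivI[where g' = "\<lambda>_. 0"]) auto

text \<open>
  If the second derivative were negative, the first derivative, which vanishes at the minimum, would
  be negative just to the right of it, and the mean value theorem would make the function smaller there.
\<close>
lemma has_second_deriv_local_min:
  assumes g: "has_second_deriv g d" and min: "\<forall>\<^sub>F t in nhds 0. g 0 \<le> g t"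
  shows "d \<ge> 0"
proof (rule ccontr)
  assume "\<not> d \<ge> 0"
  then have d: "d < 0" by simp
  obtain g' where g': "\<forall>\<^sub>F t in nhds 0. (g has_real_derivative g' t) (at t)"
      "(g' has_real_derivative d) (at 0)"
    using g unfolding has_second_deriv_def by blast
  have "\<forall>\<^sub>F t in nhds 0. (g has_real_derivative g' t) (at t) \<and> g 0 \<le> g t"
    using g'(1) min by (rule eventually_conj)
  then obtain e where e: "e > 0"
    "\<And>t. \<bar>t\<bar> < e \<Longrightarrow> (g has_real_derivative g' t) (at t) \<and> g 0 \<le> g t"
    unfolding eventually_nhds_metric by (auto simp: dist_real_def)
  have "g' 0 = 0"
    using e by (intro DERIV_local_min[of g "g' 0" 0 e]) auto
  then obtain s where s: "s > 0" "\<And>h. h > 0 \<Longrightarrow> h < s \<Longrightarrow> g' h < 0"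
    using has_real_derivative_neg_dec_right[OF g'(2) d] by auto
  define t where "t = min e s / 2"
  have t: "0 < t" "t < e" "t < s" using e(1) s(1) by (auto simp: t_def)
  obtain z where z: "0 < z" "z < t" "g t - g 0 = (t - 0) * g' z"
    using MVT2[of 0 t g g'] t e by (metis (no_types, opaque_lifting) abs_of_nonneg dual_order.strict_trans2 less_eq_real_def)
  have "(t - 0) * g' z < 0"
    using s(2)[of z] z t by (simp add: mult_pos_neg)
  moreover have "g t - g 0 \<ge> 0" using e(2)[of t] t by auto
  ultimately show False using z(3) by simp
qed

lemma has_second_deriv_const_unique:
  assumes "has_second_deriv (\<lambda>t. k) d" shows "d = 0"
  using has_second_deriv_local_min[OF assms]
    has_second_deriv_local_min[OF has_second_deriv_cmult[OF assms, of "-1"]] by auto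

lemma has_second_deriv_shift_imp_deriv:
  assumes "has_second_deriv (\<lambda>s. v (t + s)) d"
  shows "(v has_real_derivative deriv v t) (at t)"
    and "(deriv v has_real_derivative d) (at t)"
proof -
  obtain g' where g': "\<forall>\<^sub>F s in nhds 0. ((\<lambda>s. v (t + s)) has_real_derivative g' s) (at s)"
      "(g' has_real_derivative d) (at 0)"
    using assms unfolding has_second_deriv_def by blast
  have ev: "\<forall>\<^sub>F s in nhds 0. (v has_real_derivative g' s) (at (t + s))"
    using g'(1) by eventually_elim (simp add: DERIV_shift add.commute)
  show "(v has_real_derivative deriv v t) (at t)"
    using eventually_nhds_x_imp_x[OF ev] by (simp add: DERIV_imp_deriv)
  have "\<forall>\<^sub>F s in nhds 0. g' s = deriv v (s + t)"
    using ev by eventually_elim (simp add: DERIV_imp_deriv add.commute)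
  then have "((\<lambda>s. deriv v (s + t)) has_real_derivative d) (at 0)"
    using g'(2) DERIV_cong_ev[of 0 0 g' "\<lambda>s. deriv v (s + t)" d d] by simp
  then show "(deriv v has_real_derivative d) (at t)"
    using DERIV_shift[of "deriv v" d 0 t] by simp
qed

lemma has_laplacian_add:
  assumes "has_laplacian w x l" "has_laplacian z x m"
  shows "has_laplacian (\<lambda>x. w x + z x) x (l + m)"
proof -
  obtain D E where "\<forall>i\<in>Basis. has_second_deriv (\<lambda>t. w (x + t *\<^sub>R i)) (D i)" "l = sum D Basis"
    "\<forall>i\<in>Basis. has_second_deriv (\<lambda>t. z (x + t *\<^sub>R i)) (E i)" "m = sum E Basis"
    using assms unfolding has_laplacian_def by blast
  then show ?thesis unfolding has_laplacian_def
    by (intro exI[of _ "\<lambda>i. D i + E i"]) (simp add: has_second_deriv_add sum.distrib)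
qed

lemma has_laplacian_cmult:
  assumes "has_laplacian w x l"
  shows "has_laplacian (\<lambda>x. k * w x) x (k * l)"
proof -
  obtain D where "\<forall>i\<in>Basis. has_second_deriv (\<lambda>t. w (x + t *\<^sub>R i)) (D i)" "l = sum D Basis"
    using assms unfolding has_laplacian_def by blast
  then show ?thesis unfolding has_laplacian_def
    by (intro exI[of _ "\<lambda>i. k * D i"]) (simp add: has_second_deriv_cmult sum_distrib_left)
qed

lemma has_laplacian_diff:
  assumes "has_laplacian w x l" "has_laplacian z x m"
  shows "has_laplacian (\<lambda>x. w x - z x) x (l - m)"
  using has_laplacian_add[OF assms(1) has_laplacian_cmult[OF assms(2), of "-1"]] by simp

lemma has_laplacian_const: "has_laplacian (\<lambda>_. k) x 0"
  unfolding has_laplacian_def by (intro exI[of _ "\<lambda>_. 0"]) (simp add: has_second_deriv_const)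

lemma has_laplacian_const_unique: "has_laplacian (\<lambda>_. k) x l \<Longrightarrow> l = 0"
  unfolding has_laplacian_def by (auto dest!: has_second_deriv_const_unique intro!: sum.neutral)

lemma has_laplacian_translate:
  assumes "has_laplacian w (x + a) l"
  shows "has_laplacian (\<lambda>x. w (x + a)) x l"
  using assms unfolding has_laplacian_def by (simp add: add.assoc add.commute[of a])

lemma has_laplacian_local_min:
  assumes w: "has_laplacian w x l" and min: "\<forall>\<^sub>F y in nhds x. w x \<le> w y"
  shows "l \<ge> 0"
proof -
  obtain D where D: "\<forall>i\<in>Basis. has_second_deriv (\<lambda>t. w (x + t *\<^sub>R i)) (D i)" "l = sum D Basis"
    using w unfolding has_laplacian_def by blast
  have "D i \<ge> 0" if "i \<in> Basis" for i
  proof -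
    have "((\<lambda>t. x + t *\<^sub>R i) \<longlongrightarrow> x + 0 *\<^sub>R i) (nhds 0)"
      by (intro tendsto_intros filterlim_ident)
    then have "filterlim (\<lambda>t. x + t *\<^sub>R i) (nhds x) (nhds 0)" by simp
    then have "\<forall>\<^sub>F t in nhds 0. w x \<le> w (x + t *\<^sub>R i)"
      using min by (rule eventually_compose_filterlim[rotated])
    then show ?thesis
      using has_second_deriv_local_min[OF D(1)[rule_format, OF that]] by simp
  qed
  then show ?thesis unfolding D(2) by (rule sum_nonneg)
qed

lemma sum_Basis_prod:
  fixes D :: "'a::euclidean_space \<times> 'b::euclidean_space \<Rightarrow> real"
  shows "sum D Basis = (\<Sum>i\<in>Basis. D (i, 0)) + (\<Sum>j\<in>Basis. D (0, j))"
proof -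
  have "inj_on (\<lambda>u. (u::'a, 0::'b)) Basis" "inj_on (\<lambda>u. (0::'a, u::'b)) Basis"
    by (auto intro!: inj_onI Pair_inject)
  then show ?thesis unfolding Basis_prod_def
    by (subst sum.union_disjoint) (auto simp: Basis_prod_def sum.reindex)
qed

text \<open>
  The Laplacian on a product splits as a sum over the factors. Together with its converse below, this
  makes it possible to regroup variables, to add a dummy variable, and to freeze one.
\<close>
lemma has_laplacian_prodI:
  assumes "has_laplacian (\<lambda>x. w (x, y)) x l" "has_laplacian (\<lambda>y. w (x, y)) y m"
  shows "has_laplacian w (x, y) (l + m)"
proof -
  obtain D E where D: "\<forall>i\<in>Basis. has_second_deriv (\<lambda>t. w (x + t *\<^sub>R i, y)) (D i)" "l = sum D Basis"
    and E: "\<forall>i\<in>Basis. has_second_deriv (\<lambda>t. w (x, y + t *\<^sub>R i)) (E i)" "m = sum E Basis"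
    using assms unfolding has_laplacian_def by blast
  show ?thesis unfolding has_laplacian_def
  proof (intro exI[of _ "\<lambda>p. if snd p = 0 then D (fst p) else E (snd p)"] conjI)
    show "l + m = (\<Sum>p\<in>Basis. if snd p = 0 then D (fst p) else E (snd p))"
      unfolding sum_Basis_prod D E by (auto intro!: sum.cong)
    show "\<forall>p\<in>Basis. has_second_deriv (\<lambda>t. w ((x, y) + t *\<^sub>R p))
            (if snd p = 0 then D (fst p) else E (snd p))"
      using D E by (auto simp: Basis_prod_def)
  qed
qed

lemma has_laplacian_prodE:
  assumes "has_laplacian w (x, y) k"
  obtains l m where "k = l + m" "has_laplacian (\<lambda>x. w (x, y)) x l"
    "has_laplacian (\<lambda>y. w (x, y)) y m"
proof -
  obtain D where D: "\<forall>i\<in>Basis. has_second_deriv (\<lambda>t. w ((x, y) + t *\<^sub>R i)) (D i)" "k = sum D Basis"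
    using assms unfolding has_laplacian_def by blast
  have "has_second_deriv (\<lambda>t. w (x + t *\<^sub>R i, y)) (D (i, 0))" if "i \<in> Basis" for i
    using D(1)[rule_format, of "(i, 0)"] that by (simp add: Basis_prod_def)
  moreover have "has_second_deriv (\<lambda>t. w (x, y + t *\<^sub>R j)) (D (0, j))" if "j \<in> Basis" for j
    using D(1)[rule_format, of "(0, j)"] that by (simp add: Basis_prod_def)
  ultimately have "has_laplacian (\<lambda>x. w (x, y)) x (\<Sum>i\<in>Basis. D (i, 0))"
    "has_laplacian (\<lambda>y. w (x, y)) y (\<Sum>j\<in>Basis. D (0, j))"
    unfolding has_laplacian_def
    by (intro exI[of _ "\<lambda>i. D (i, 0)"] exI[of _ "\<lambda>j. D (0, j)"]; simp)+
  then show ?thesis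
    using that D(2) sum_Basis_prod by metis
qed

lemma has_laplacian_real_iff:
  "has_laplacian w (t::real) l \<longleftrightarrow> has_second_deriv (\<lambda>s. w (t + s)) l"
  unfolding has_laplacian_def by (auto intro: exI[of _ "\<lambda>_. l"])

lemma has_laplacian_real:
  assumes "\<And>s. (w has_real_derivative w' s) (at s)" "(w' has_real_derivative l) (at t)"
  shows "has_laplacian w (t::real) l"
  unfolding has_laplacian_real_iff
proof (rule has_second_derivI)
  show "((\<lambda>s. w (t + s)) has_real_derivative w' (t + s)) (at s)" for s
    using assms(1)[of "s + t"] by (simp add: DERIV_shift add.commute)
  show "((\<lambda>s. w' (t + s)) has_real_derivative l) (at 0)"
    using assms(2) DERIV_shift[of w' l 0 t] by (simp add: add.commute)
qed

lemma has_laplacian_quadratic: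
  fixes x z :: "'a::euclidean_space"
  shows "has_laplacian (\<lambda>x. a + b * ((x - z) \<bullet> (x - z))) x (2 * b * DIM('a))"
  unfolding has_laplacian_def
proof (intro exI[of _ "\<lambda>_. 2 * b"] conjI ballI)
  fix i :: 'a assume i: "i \<in> Basis"
  show "has_second_deriv (\<lambda>t. a + b * ((x + t *\<^sub>R i - z) \<bullet> (x + t *\<^sub>R i - z))) (2 * b)"
  proof (rule has_second_derivI)
    have "(x + t *\<^sub>R i - z) \<bullet> (x + t *\<^sub>R i - z) = (x - z) \<bullet> (x - z) + 2 * t * ((x - z) \<bullet> i) + t\<^sup>2" for t
      using i by (simp add: algebra_simps inner_commute power2_eq_square)
    then show "((\<lambda>t. a + b * ((x + t *\<^sub>R i - z) \<bullet> (x + t *\<^sub>R i - z)))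
        has_real_derivative b * (2 * ((x - z) \<bullet> i) + 2 * t)) (at t)" for t
      by (auto intro!: derivative_eq_intros)
    show "((\<lambda>t. b * (2 * ((x - z) \<bullet> i) + 2 * t)) has_real_derivative 2 * b) (at 0)"
      by (auto intro!: derivative_eq_intros)
  qed
qed simp

lemma C2_closure_has_laplacian:
  assumes "C2_closure S u" "open S" "x \<in> S"
  shows "has_laplacian u x (laplacian u x)"
  unfolding has_laplacian_def laplacian_def
proof (intro exI[of _ "\<lambda>i. partial_deriv i (partial_deriv i u) x"] conjI ballI refl)
  fix i :: 'a assume i: "i \<in> Basis"
  let ?g = "\<lambda>t. u (x + t *\<^sub>R i)" and ?h = "\<lambda>t. partial_deriv i u (x + t *\<^sub>R i)"
  have "has_partial i (partial_deriv i u) x" using assms i unfolding C2_closure_def by blast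
  then have "(?h has_real_derivative partial_deriv i (partial_deriv i u) x) (at 0)"
    unfolding has_partial_def partial_deriv_def[of i "partial_deriv i u"]
    by (simp add: real_differentiable_def DERIV_deriv_iff_real_differentiable)
  moreover have "((\<lambda>t. x + t *\<^sub>R i) \<longlongrightarrow> x + 0 *\<^sub>R i) (nhds 0)"
    by (intro tendsto_intros filterlim_ident)
  then have "\<forall>\<^sub>F t in nhds 0. x + t *\<^sub>R i \<in> S"
    using assms(2,3) by (auto intro: topological_tendstoD)
  then have "\<forall>\<^sub>F t in nhds 0. (?g has_real_derivative ?h t) (at t)"
  proof eventually_elim
    case (elim t)
    then have "has_partial i u (x + t *\<^sub>R i)" using assms i unfolding C2_closure_def by blast
    then have "((\<lambda>s. ?g (s + t)) has_real_derivative ?h t) (at 0)"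
      unfolding has_partial_def partial_deriv_def
      by (simp add: DERIV_deriv_iff_real_differentiable algebra_simps)
    then show ?case using DERIV_shift[of ?g _ 0 t] by simp
  qed
  ultimately show "has_second_deriv ?g (partial_deriv i (partial_deriv i u) x)"
    unfolding has_second_deriv_def by (intro exI[of _ ?h]) simp
qed

section \<open>A maximum principle on unbounded cylinders\<close>

text \<open>
  A negative infimum of \<open>w\<close> over the unbounded cylinder need not be attained, but a negative infimum of
  \<open>w / \<Psi>\<close> is, if \<open>\<Psi>\<close> is positive and tends to infinity while \<open>w\<close> is bounded below. With
  \<open>\<sigma> < 0\<close> that minimum, \<open>w - \<sigma> * \<Psi>\<close> is nonnegative and vanishes at an interior point, so its
  Laplacian there is nonnegative; this is impossible when \<open>\<Delta> w \<le> - \<Lambda> w\<close> and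
  \<open>\<Delta> \<Psi> < - \<Lambda> \<Psi>\<close>. For \<open>\<Lambda> > 0\<close> such a \<open>\<Psi>\<close> exists only on a thin
  cross section, which is what the bound on \<open>r\<close> expresses; for \<open>\<Lambda> \<le> 0\<close> radius one is allowed.
\<close>
lemma cylinder_maximum_principle:
  fixes w :: "'a::euclidean_space \<times> 'b::euclidean_space \<Rightarrow> real"
  assumes C: "compact C" "C \<subseteq> cball ctr r" and T: "open T" "T \<subseteq> C"
    and size: "(max \<Lambda> 0 + 1) * r\<^sup>2 \<le> 1"
    and cont: "continuous_on (UNIV \<times> C) w"
    and bounded_below: "\<And>x y. y \<in> C \<Longrightarrow> - B \<le> w (x, y)"
    and bdry: "\<And>x y. y \<in> C \<Longrightarrow> y \<notin> T \<Longrightarrow> 0 \<le> w (x, y)"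
    and lap: "\<And>x y. y \<in> T \<Longrightarrow> w (x, y) < 0 \<Longrightarrow>
                \<exists>l. has_laplacian w (x, y) l \<and> l \<le> - \<Lambda> * w (x, y)"
    and y: "y \<in> C"
  shows "0 \<le> w (x, y)"
proof (rule ccontr)
  assume neg: "\<not> 0 \<le> w (x, y)"
  \<comment> \<open>The factor in \<open>y\<close> is a concave paraboloid with values in \<open>[1, 2]\<close> on the cross section; its
      curvature outweighs both the term \<open>\<Lambda> \<Psi>\<close> and the growth in \<open>x\<close>, made slow by the choice
      of \<open>\<delta>\<close>. The form \<open>x - 0\<close> is the one to which the quadratic lemma applies.\<close>
  define K where "K = max \<Lambda> 0 + 1"
  define \<delta> where "\<delta> = 1 / (4 * real DIM('a))"
  define \<phi> where "\<phi> y = 2 + (- K) * ((y - ctr) \<bullet> (y - ctr))" for y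
  define Q where "Q x = 1 + \<delta> * ((x - 0) \<bullet> (x - 0))" for x :: 'a
  define \<Psi> where "\<Psi> p = \<phi> (snd p) * Q (fst p)" for p
  have \<delta>: "\<delta> > 0" by (simp add: \<delta>_def)
  have K: "K \<ge> 1" "K \<ge> \<Lambda> + 1" by (auto simp: K_def)
  have Q: "Q x \<ge> 1" for x using \<delta> by (simp add: Q_def)
  have \<phi>: "1 \<le> \<phi> y" "\<phi> y \<le> 2" if "y \<in> C" for y
  proof -
    have "norm (y - ctr) \<le> r" using C(2) that by (auto simp: dist_norm norm_minus_commute)
    then have "(norm (y - ctr))\<^sup>2 \<le> r\<^sup>2" by (intro power_mono) auto
    then have "K * (norm (y - ctr))\<^sup>2 \<le> K * r\<^sup>2" using K by (intro mult_left_mono) auto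
    also have "\<dots> \<le> 1" using size by (simp add: K_def)
    finally show "1 \<le> \<phi> y" by (simp add: \<phi>_def power2_norm_eq_inner)
    show "\<phi> y \<le> 2" using K by (simp add: \<phi>_def)
  qed
  have \<Psi>: "\<Psi> (x, y) \<ge> Q x" "\<Psi> (x, y) > 0" if "y \<in> C" for x y
    using mult_mono[of 1 "\<phi> y" "Q x" "Q x"] \<phi>[OF that] Q[of x] by (auto simp: \<Psi>_def)
  have lap\<Psi>: "\<exists>l. has_laplacian \<Psi> (x, y) l \<and> l < - \<Lambda> * \<Psi> (x, y)" if "y \<in> C" for x y
  proof (intro exI conjI)
    have 1: "has_laplacian (\<lambda>x. \<phi> y + (\<phi> y * \<delta>) * ((x - 0) \<bullet> (x - 0))) x (2 * (\<phi> y * \<delta>) * DIM('a))"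
      by (rule has_laplacian_quadratic)
    have 2: "has_laplacian (\<lambda>y. 2 * Q x + (- (K * Q x)) * ((y - ctr) \<bullet> (y - ctr))) y
        (2 * (- (K * Q x)) * DIM('b))"
      by (rule has_laplacian_quadratic)
    show "has_laplacian \<Psi> (x, y) (2 * (\<phi> y * \<delta>) * DIM('a) + 2 * (- (K * Q x)) * DIM('b))"
    proof (rule has_laplacian_prodI)
      show "has_laplacian (\<lambda>x. \<Psi> (x, y)) x (2 * (\<phi> y * \<delta>) * DIM('a))"
        using 1 by (simp add: \<Psi>_def Q_def algebra_simps)
      show "has_laplacian (\<lambda>y. \<Psi> (x, y)) y (2 * (- (K * Q x)) * DIM('b))"
        using 2 by (simp add: \<Psi>_def \<phi>_def algebra_simps)
    qed
    have "2 * (\<phi> y * \<delta>) * DIM('a) = \<phi> y / 2" by (simp add: \<delta>_def)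
    also have "\<dots> \<le> Q x" using \<phi>[OF that] Q[of x] by linarith
    finally have a: "2 * (\<phi> y * \<delta>) * DIM('a) \<le> Q x" .
    have "K * Q x * 1 \<le> K * Q x * DIM('b)"
      using K Q[of x] by (intro mult_left_mono) (auto simp: DIM_positive Suc_leI)
    then have b: "2 * (- (K * Q x)) * DIM('b) \<le> - 2 * (K * Q x)" by simp
    have "\<Lambda> * \<Psi> (x, y) \<le> (K - 1) * \<Psi> (x, y)"
      using K \<Psi>[OF that, of x] by (intro mult_right_mono) auto
    also have "\<dots> \<le> (K - 1) * (2 * Q x)"
      using K \<phi>[OF that] Q[of x] by (intro mult_left_mono) (auto simp: \<Psi>_def intro!: mult_right_mono)
    finally have c: "\<Lambda> * \<Psi> (x, y) \<le> 2 * (K * Q x) - 2 * Q x" by (simp add: algebra_simps)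
    show "2 * (\<phi> y * \<delta>) * DIM('a) + 2 * (- (K * Q x)) * DIM('b) < - \<Lambda> * \<Psi> (x, y)"
      using a b c Q[of x] by simp
  qed
  have cont\<Psi>: "continuous_on (UNIV \<times> C) \<Psi>"
    unfolding \<Psi>_def \<phi>_def Q_def by (intro continuous_intros)
  define q where "q p = w p / \<Psi> p" for p
  have contq: "continuous_on (UNIV \<times> C) q"
    unfolding q_def using \<Psi>(2) by (intro continuous_intros cont cont\<Psi>) (metis SigmaE less_irrefl)
  have q0: "q (x, y) < 0"
    using neg \<Psi>(2)[OF y, of x] by (simp add: q_def divide_neg_pos)
  \<comment> \<open>For \<open>norm x' > R\<close> the growth of \<open>\<Psi>\<close> alone keeps \<open>w / \<Psi>\<close> above its value at \<open>(x, y)\<close>;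
      adding \<open>1\<close> gives \<open>R \<le> R\<^sup>2\<close>.\<close>
  define R where "R = max (norm x) (B / (\<delta> * (- q (x, y))))  + 1"
  have R: "R \<ge> 1" "norm x \<le> R" by (simp_all add: R_def le_max_iff_disj)
  have "compact (cball (0::'a) R \<times> C)" "cball (0::'a) R \<times> C \<noteq> {}"
    using C y R by (auto intro!: compact_Times)
  moreover have "continuous_on (cball (0::'a) R \<times> C) q"
    by (rule continuous_on_subset[OF contq]) auto
  ultimately obtain p where p: "p \<in> cball 0 R \<times> C" "\<And>p'. p' \<in> cball 0 R \<times> C \<Longrightarrow> q p \<le> q p'"
    using continuous_attains_inf by metis
  obtain a b where ab: "p = (a, b)" by fastforce
  have b: "b \<in> C" using p ab by auto
  define \<sigma> where "\<sigma> = q (a, b)"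
  have \<sigma>xy: "\<sigma> \<le> q (x, y)" using p(2)[of "(x, y)"] R y by (auto simp: \<sigma>_def ab)
  have \<sigma>: "\<sigma> < 0" using \<sigma>xy q0 by simp
  have glob: "\<sigma> \<le> q (x', y')" if y': "y' \<in> C" for x' y'
  proof (cases "norm x' \<le> R")
    case True
    then show ?thesis using p(2)[of "(x', y')"] y' by (auto simp: \<sigma>_def ab)
  next
    case False
    have "B / (\<delta> * (- q (x, y))) \<le> R" by (simp add: R_def)
    moreover have pos: "0 < - q (x, y)" using q0 by simp
    then have "0 < \<delta> * (- q (x, y))" by (rule mult_pos_pos[OF \<delta>])
    ultimately have "B \<le> R * (\<delta> * (- q (x, y)))" by (simp only: pos_divide_le_eq)
    then have "B / (- q (x, y)) \<le> \<delta> * R"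
      unfolding pos_divide_le_eq[OF pos] by (simp only: mult_ac)
    also have "\<dots> \<le> \<delta> * (R * R)" using R \<delta> by (intro mult_left_mono) auto
    also have "\<dots> \<le> \<delta> * (norm x' * norm x')"
      using R \<delta> False by (intro mult_left_mono mult_mono) auto
    also have "\<dots> \<le> Q x'" by (simp add: Q_def flip: power2_norm_eq_inner power2_eq_square)
    also have "\<dots> \<le> \<Psi> (x', y')" using \<Psi>[OF y'] by simp
    finally have "B \<le> - q (x, y) * \<Psi> (x', y')" using q0 by (simp add: field_simps)
    then have "q (x, y) * \<Psi> (x', y') \<le> w (x', y')" using bounded_below[OF y', of x'] by simp
    then have "q (x, y) \<le> q (x', y')"
      using \<Psi>(2)[OF y', of x'] by (simp add: q_def field_simps)
    then show ?thesis using \<sigma>xy by simp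
  qed
  have wab: "w (a, b) = \<sigma> * \<Psi> (a, b)" using \<Psi>(2)[OF b, of a] by (simp add: \<sigma>_def q_def)
  have "w (a, b) < 0" using wab \<sigma> \<Psi>(2)[OF b, of a] by (simp add: mult_neg_pos)
  then have bT: "b \<in> T" using bdry[OF b, of a] by auto
  obtain l where l: "has_laplacian w (a, b) l" "l \<le> - \<Lambda> * w (a, b)"
    using lap[OF bT \<open>w (a, b) < 0\<close>] by auto
  obtain m where m: "has_laplacian \<Psi> (a, b) m" "m < - \<Lambda> * \<Psi> (a, b)"
    using lap\<Psi>[OF b] by auto
  have "0 \<le> l - \<sigma> * m"
  proof (rule has_laplacian_local_min)
    show "has_laplacian (\<lambda>p. w p - \<sigma> * \<Psi> p) (a, b) (l - \<sigma> * m)"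
      by (intro has_laplacian_diff has_laplacian_cmult l m)
    have "\<forall>\<^sub>F p in nhds (a, b). p \<in> UNIV \<times> T"
      using bT T(1) by (intro eventually_nhds_in_open open_Times) auto
    then show "\<forall>\<^sub>F p in nhds (a, b). w (a, b) - \<sigma> * \<Psi> (a, b) \<le> w p - \<sigma> * \<Psi> p"
    proof eventually_elim
      case (elim p)
      then have "\<sigma> \<le> q p" "\<Psi> p > 0" using glob \<Psi>(2) T(2) by (cases p; force)+
      then show ?case using wab by (simp add: q_def field_simps)
    qed
  qed
  moreover have "\<sigma> * (- \<Lambda> * \<Psi> (a, b)) < \<sigma> * m" using m(2) \<sigma> by (rule mult_strict_left_mono_neg)
  ultimately show False using l(2) wab by (simp add: mult.left_commute)
qed

lemma slab_maximum_principle: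
  fixes w :: "'a::euclidean_space \<times> real \<Rightarrow> real"
  assumes size: "\<beta> - \<alpha> \<le> r" "(max \<Lambda> 0 + 1) * r\<^sup>2 \<le> 1"
    and cont: "continuous_on (UNIV \<times> {\<alpha>..\<beta>}) w"
    and bounded_below: "\<And>x t. t \<in> {\<alpha>..\<beta>} \<Longrightarrow> - B \<le> w (x, t)"
    and bdry: "\<And>x. 0 \<le> w (x, \<alpha>)" "\<And>x. 0 \<le> w (x, \<beta>)"
    and lap: "\<And>x t. \<alpha> < t \<Longrightarrow> t < \<beta> \<Longrightarrow> w (x, t) < 0 \<Longrightarrow>
                \<exists>l. has_laplacian w (x, t) l \<and> l \<le> - \<Lambda> * w (x, t)"
    and t: "\<alpha> \<le> t" "t \<le> \<beta>"
  shows "0 \<le> w (x, t)"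
proof (rule cylinder_maximum_principle[where C = "{\<alpha>..\<beta>}" and T = "{\<alpha><..<\<beta>}" and ctr = \<alpha>
      and r = r and \<Lambda> = \<Lambda> and B = B])
  show "{\<alpha>..\<beta>} \<subseteq> cball \<alpha> r" using size(1) by (auto simp: dist_real_def)
  fix x y assume "y \<in> {\<alpha>..\<beta>}" "y \<notin> {\<alpha><..<\<beta>}"
  then have "y = \<alpha> \<or> y = \<beta>" by auto
  then show "0 \<le> w (x, y)" using bdry by auto
qed (use assms in auto)

lemma has_laplacian_snd:
  assumes "has_laplacian g t l"
  shows "has_laplacian (\<lambda>p. g (snd p)) (x, t) l"
  using has_laplacian_prodI[of "\<lambda>p. g (snd p)" t x 0 l] assms has_laplacian_const[of "g t" x] by simp

section \<open>An exponential barrier\<close>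

lemma sq_dominates: "0 \<le> L \<Longrightarrow> L \<le> (L + 1)\<^sup>2" for L :: real
  by (simp add: power2_eq_square algebra_simps)

text \<open>
  The function \<open>\<psi> t = A (exp (\<mu> (t - z)) - 1)\<close> satisfies \<open>\<psi>'' \<ge> L \<psi>\<close>, so it stays below any
  nonnegative \<open>w\<close> with \<open>\<Delta> w \<le> L w\<close> that dominates it on the two faces. If \<open>z\<close> is one of the faces
  and \<open>\<mu>\<close> points away from it, \<open>\<psi>\<close> vanishes there and is positive elsewhere: a positive lower bound on the other face
  spreads, uniformly in \<open>x\<close>, to every smaller slab that stays away from the face \<open>z\<close>. This replaces the strong maximum principle and the
  passage to limits of translates.
\<close>
lemma exponential_minorant:
  fixes w :: "'a::euclidean_space \<times> real \<Rightarrow> real"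
  assumes len: "\<beta> - \<alpha> \<le> 1" and cont: "continuous_on (UNIV \<times> {\<alpha>..\<beta>}) w"
    and nonneg: "\<And>x t. t \<in> {\<alpha>..\<beta>} \<Longrightarrow> 0 \<le> w (x, t)"
    and params: "0 \<le> L" "L \<le> \<mu>\<^sup>2" "0 \<le> A"
    and bdry: "\<And>x. A * (exp (\<mu> * (\<alpha> - z)) - 1) \<le> w (x, \<alpha>)"
      "\<And>x. A * (exp (\<mu> * (\<beta> - z)) - 1) \<le> w (x, \<beta>)"
    and lap: "\<And>x t. \<alpha> < t \<Longrightarrow> t < \<beta> \<Longrightarrow> \<exists>l. has_laplacian w (x, t) l \<and> l \<le> L * w (x, t)"
    and t: "\<alpha> \<le> t" "t \<le> \<beta>"
  shows "A * (exp (\<mu> * (t - z)) - 1) \<le> w (x, t)"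
proof -
  define \<psi> where "\<psi> t = A * (exp (\<mu> * (t - z)) - 1)" for t
  have "compact (\<psi> ` {\<alpha>..\<beta>})"
    unfolding \<psi>_def by (intro compact_continuous_image continuous_intros) auto
  then obtain B where B: "\<And>t. t \<in> {\<alpha>..\<beta>} \<Longrightarrow> norm (\<psi> t) \<le> B"
    using compact_imp_bounded bounded_iff by (metis imageI)
  have "0 \<le> w (x, t) - \<psi> (snd (x, t))"
  proof (rule slab_maximum_principle[where w = "\<lambda>p. w p - \<psi> (snd p)" and \<alpha> = \<alpha> and \<beta> = \<beta>
        and r = 1 and \<Lambda> = "- L" and B = B])
    show "continuous_on (UNIV \<times> {\<alpha>..\<beta>}) (\<lambda>p. w p - \<psi> (snd p))"
      unfolding \<psi>_def by (intro continuous_intros cont)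
    show "- B \<le> w (x, t) - \<psi> (snd (x, t))" if "t \<in> {\<alpha>..\<beta>}" for x t
      using B[OF that] nonneg[OF that, of x] by simp
    show "\<exists>l. has_laplacian (\<lambda>p. w p - \<psi> (snd p)) (x, t) l \<and> l \<le> - (- L) * (w (x, t) - \<psi> (snd (x, t)))"
      if tt: "\<alpha> < t" "t < \<beta>" for x t
    proof -
      obtain l where l: "has_laplacian w (x, t) l" "l \<le> L * w (x, t)" using lap[OF tt] by auto
      have "has_laplacian \<psi> t (A * \<mu>\<^sup>2 * exp (\<mu> * (t - z)))"
        unfolding \<psi>_def
        by (rule has_laplacian_real[where w' = "\<lambda>s. A * \<mu> * exp (\<mu> * (s - z))"])
          (auto intro!: derivative_eq_intros simp: power2_eq_square)
      then have "has_laplacian (\<lambda>p. w p - \<psi> (snd p)) (x, t) (l - A * \<mu>\<^sup>2 * exp (\<mu> * (t - z)))"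
        by (intro has_laplacian_diff l has_laplacian_snd)
      moreover have "L * \<psi> t \<le> A * (L * exp (\<mu> * (t - z)))"
        using params by (simp add: \<psi>_def algebra_simps)
      moreover have "\<dots> \<le> A * (\<mu>\<^sup>2 * exp (\<mu> * (t - z)))"
        using params by (intro mult_left_mono mult_right_mono) auto
      ultimately show ?thesis using l(2) by (intro exI conjI) (auto simp: algebra_simps)
    qed
  qed (use len params bdry t in \<open>auto simp: \<psi>_def\<close>)
  then show ?thesis by (simp add: \<psi>_def)
qed

section \<open>A Lipschitz bound across the slab\<close>

text \<open>
  The Lipschitz constant is taken on \<open>{0..c}\<close>, a compact set that contains
  all values of \<open>u\<close>, since \<open>f\<close> is only locally Lipschitz.
\<close>
locale slab_solution =
  fixes f :: "real \<Rightarrow> real" and u :: "'a::euclidean_space \<times> real \<Rightarrow> real" and c L :: real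
  assumes L_nonneg: "0 \<le> L" and c_pos: "0 < c"
    and lipschitz: "\<And>a b. a \<in> {0..c} \<Longrightarrow> b \<in> {0..c} \<Longrightarrow> \<bar>f a - f b\<bar> \<le> L * \<bar>a - b\<bar>"
    and cont: "continuous_on (UNIV \<times> {0..1}) u"
    and range: "\<And>x t. t \<in> {0..1} \<Longrightarrow> u (x, t) \<in> {0..c}"
    and bottom: "\<And>x. u (x, 0) = 0" and top: "\<And>x. u (x, 1) = c"
    and lap: "\<And>x t. 0 < t \<Longrightarrow> t < 1 \<Longrightarrow> has_laplacian u (x, t) (- f (u (x, t)))"
begin

definition M :: real where "M = \<bar>f 0\<bar> + L * c"

lemma f_bounds:
  assumes "a \<in> {0..c}"
  shows "- M \<le> f a" "f a \<le> M" "f 0 - L * a \<le> f a" "0 \<le> M"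
proof -
  have "\<bar>f a - f 0\<bar> \<le> L * a" "L * a \<le> L * c"
    using lipschitz[of a 0] assms c_pos L_nonneg by (auto intro: mult_left_mono)
  then show "- M \<le> f a" "f a \<le> M" "f 0 - L * a \<le> f a" unfolding M_def by linarith+
  show "0 \<le> M" using L_nonneg c_pos by (simp add: M_def)
qed

lemma has_laplacian_parabola:
  "has_laplacian (\<lambda>t. a + b * t + M / 2 * (t * (1 - t))) (t::real) (- M)"
  by (rule has_laplacian_real[where w' = "\<lambda>t. b + M / 2 * (1 - 2 * t)"])
    (auto intro!: derivative_eq_intros simp: field_simps)

text \<open>
  The bounds come from comparing \<open>u\<close> with the two parabolas that have its boundary values and whose second
  derivatives are \<open>- M\<close> and \<open>M\<close>.
\<close>
lemma linear_bounds:
  assumes t: "t \<in> {0..1}"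
  shows "u (x, t) \<le> (c + M / 2) * t" "c - u (x, t) \<le> (c + M / 2) * (1 - t)"
proof -
  have M: "0 \<le> M" using f_bounds(4)[of 0] c_pos by simp
  have q: "0 \<le> M / 2 * (t * (1 - t))" if "t \<in> {0..1}" for t
    using that M by (intro mult_nonneg_nonneg) auto
  let ?w = "\<lambda>p. (0 + c * snd p + M / 2 * (snd p * (1 - snd p))) - u p"
  have "0 \<le> ?w (x, t)"
  proof (rule slab_maximum_principle[where \<alpha> = 0 and \<beta> = 1 and r = 1 and \<Lambda> = 0 and B = c])
    show "continuous_on (UNIV \<times> {0..1}) ?w"
      by (intro continuous_intros cont)
    show "- c \<le> ?w (x, t)"
      if "t \<in> {0..1}" for x t
      using range[OF that, of x] q[OF that] mult_nonneg_nonneg[of c t] c_pos that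
      by (simp; linarith)
    show "\<exists>l. has_laplacian ?w (x, t) l \<and>
        l \<le> - 0 * (?w (x, t))"
      if tt: "0 < t" "t < 1" for x t
    proof (intro exI conjI)
      show "has_laplacian ?w (x, t)
          (- M - (- f (u (x, t))))"
        by (intro has_laplacian_diff has_laplacian_snd has_laplacian_parabola lap tt)
      show "- M - - f (u (x, t)) \<le> - 0 * (?w (x, t))"
        using f_bounds(2)[OF range[of t x]] tt by simp
    qed
  qed (use t bottom top in auto)
  then have "u (x, t) \<le> c * t + M / 2 * (t * (1 - t))" by simp
  also have "\<dots> \<le> c * t + M / 2 * (t * 1)"
    using t M by (intro add_left_mono mult_left_mono) auto
  finally show "u (x, t) \<le> (c + M / 2) * t" by (simp add: algebra_simps)
  let ?z = "\<lambda>p. u p - (c * snd p - M / 2 * (snd p * (1 - snd p)))"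
  have "0 \<le> ?z (x, t)"
  proof (rule slab_maximum_principle[where \<alpha> = 0 and \<beta> = 1 and r = 1 and \<Lambda> = 0 and B = c])
    show "continuous_on (UNIV \<times> {0..1}) ?z"
      by (intro continuous_intros cont)
    show "- c \<le> ?z (x, t)"
      if "t \<in> {0..1}" for x t
      using range[OF that, of x] q[OF that] mult_left_le[of t c] c_pos that
      by (simp; linarith)
    show "\<exists>l. has_laplacian ?z (x, t) l \<and>
        l \<le> - 0 * (?z (x, t))"
      if tt: "0 < t" "t < 1" for x t
    proof (intro exI conjI)
      have "has_laplacian (\<lambda>p. u p + (0 + (- c) * snd p + M / 2 * (snd p * (1 - snd p)))) (x, t)
          (- f (u (x, t)) + (- M))"
        by (intro has_laplacian_add has_laplacian_snd has_laplacian_parabola lap tt)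
      then show "has_laplacian ?z (x, t)
          (- f (u (x, t)) + (- M))"
        by (simp add: algebra_simps)
      show "- f (u (x, t)) + (- M) \<le> - 0 * (?z (x, t))"
        using f_bounds(1)[OF range[of t x]] tt by simp
    qed
  qed (use t bottom top in auto)
  then have "c - u (x, t) \<le> c * (1 - t) + M / 2 * (t * (1 - t))" by (simp add: algebra_simps)
  also have "\<dots> \<le> c * (1 - t) + M / 2 * (1 * (1 - t))"
    using t M by (intro add_left_mono mult_left_mono mult_right_mono) auto
  finally show "c - u (x, t) \<le> (c + M / 2) * (1 - t)" by (simp add: algebra_simps)
qed

text \<open>
  No elliptic regularity theory is used: the height is doubled. The function
  \<open>(x, (a, b)) \<mapsto> u (x, a) - u (x, b)\<close> on the cylinder over the triangle \<open>0 < b < a < 1\<close> has Laplacian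
  \<open>f (u (x, b)) - f (u (x, a))\<close>, which is bounded by \<open>2 * M\<close>, because \<open>x\<close> enters both terms in the same
  place. It vanishes on the side \<open>a = b\<close>, and on the two other sides it is at most \<open>(c + M / 2) * (a - b)\<close> by
  the linear bounds. Subtracting a square from a linear function of \<open>a - b\<close> gives an explicit barrier.
\<close>
lemma vertical_lipschitz:
  assumes ab: "0 \<le> b" "b \<le> a" "a \<le> 1"
  shows "u (x, a) - u (x, b) \<le> (c + M) * (a - b)"
proof -
  define C where "C = ({0..1} \<times> {0..1}) \<inter> {p :: real \<times> real. snd p \<le> fst p}"
  define T where "T = ({0<..<1} \<times> {0<..<1}) \<inter> {p :: real \<times> real. snd p < fst p}"
  define \<Phi> where "\<Phi> q = (c + M) * (fst q - snd q) - M / 2 * (fst q - snd q)\<^sup>2" for q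
  define w where "w p = \<Phi> (snd p) - (u (fst p, fst (snd p)) - u (fst p, snd (snd p)))" for p
  have M: "0 \<le> M" using f_bounds(4)[of 0] c_pos by simp
  have \<Phi>: "(c + M / 2) * (a - b) \<le> \<Phi> (a, b)" if "0 \<le> a - b" "a - b \<le> 1" for a b
  proof -
    have "M / 2 * ((a - b) * (a - b)) \<le> M / 2 * ((a - b) * 1)"
      using that M by (intro mult_left_mono) auto
    moreover have "(c + M) * (a - b) = (c + M / 2) * (a - b) + M / 2 * (a - b)"
      by (simp add: field_simps)
    ultimately show ?thesis by (simp add: \<Phi>_def power2_eq_square)
  qed
  have "0 \<le> w (x, (a, b))"
  proof (rule cylinder_maximum_principle[where C = C and T = T and ctr = "(1/2, 1/2)" and r = 1
        and \<Lambda> = 0 and B = c])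
    show "compact C" unfolding C_def
      by (intro compact_Int_closed compact_Times closed_Collect_le continuous_intros) auto
    show "open T" unfolding T_def
      by (intro open_Int open_Times open_Collect_less continuous_intros)
    show "T \<subseteq> C" by (auto simp: T_def C_def)
    show "C \<subseteq> cball (1/2, 1/2) 1"
    proof
      fix p assume "p \<in> C"
      then obtain a b where p: "p = (a, b)" "0 \<le> a" "a \<le> 1" "0 \<le> b" "b \<le> 1"
        by (cases p) (auto simp: C_def)
      then have "0 \<le> a * (1 - a)" "0 \<le> b * (1 - b)" by simp_all
      then have "(1/2 - a)\<^sup>2 + (1/2 - b)\<^sup>2 \<le> 1"
        by (simp add: power2_eq_square algebra_simps)
      then show "p \<in> cball (1/2, 1/2) 1" by (simp add: p(1) dist_Pair_Pair dist_real_def)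
    qed
    have "continuous_on (UNIV \<times> C) (\<lambda>p. u (fst p, fst (snd p)))"
      "continuous_on (UNIV \<times> C) (\<lambda>p. u (fst p, snd (snd p)))"
      by (rule continuous_on_compose2[OF cont]; force intro!: continuous_intros simp: C_def)+
    then show "continuous_on (UNIV \<times> C) w"
      unfolding w_def \<Phi>_def by (intro continuous_intros)
    show "(a, b) \<in> C" using ab by (auto simp: C_def)
    have C_ab: "0 \<le> b" "b \<le> a" "a \<le> 1" if "(a, b) \<in> C" for a b using that by (auto simp: C_def)
    show "- c \<le> w (x, q)" if "q \<in> C" for x q
    proof -
      obtain a b where q: "q = (a, b)" by fastforce
      have ab: "0 \<le> b" "b \<le> a" "a \<le> 1" using that C_ab q by auto
      have "0 \<le> (c + M / 2) * (a - b)" using M c_pos ab by (intro mult_nonneg_nonneg) auto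
      then show ?thesis using \<Phi>[of a b] ab range[of a x] range[of b x] by (simp add: w_def q)
    qed
    show "0 \<le> w (x, q)" if "q \<in> C" "q \<notin> T" for x q
    proof -
      obtain a b where q: "q = (a, b)" by fastforce
      have ab: "0 \<le> b" "b \<le> a" "a \<le> 1" using that(1) C_ab q by auto
      then have "a = b \<or> b = 0 \<or> a = 1" using that(2) by (auto simp: T_def q)
      then consider "a = b" | "b = 0" | "a = 1" by blast
      then show ?thesis
      proof cases
        case 1 then show ?thesis by (simp add: w_def \<Phi>_def q)
      next
        case 2 then show ?thesis
          using \<Phi>[of a b] ab linear_bounds(1)[of a x] by (simp add: w_def q bottom)
      next
        case 3 then show ?thesis
          using \<Phi>[of a b] ab linear_bounds(2)[of b x] by (simp add: w_def q top)
      qed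
    qed
    show "\<exists>l. has_laplacian w (x, q) l \<and> l \<le> - 0 * w (x, q)" if "q \<in> T" for x q
    proof -
      obtain a b where q: "q = (a, b)" by fastforce
      have ab: "0 < b" "b < 1" "0 < a" "a < 1" using that by (auto simp: T_def q)
      obtain l1 m1 where 1: "- f (u (x, a)) = l1 + m1" "has_laplacian (\<lambda>x. u (x, a)) x l1"
        "has_laplacian (\<lambda>t. u (x, t)) a m1" using has_laplacian_prodE[OF lap[OF ab(3,4), of x]] .
      obtain l2 m2 where 2: "- f (u (x, b)) = l2 + m2" "has_laplacian (\<lambda>x. u (x, b)) x l2"
        "has_laplacian (\<lambda>t. u (x, t)) b m2" using has_laplacian_prodE[OF lap[OF ab(1,2), of x]] .
      have \<Phi>a: "has_laplacian (\<lambda>s. \<Phi> (s, b)) a (- M)"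
        unfolding \<Phi>_def
        by (rule has_laplacian_real[where w' = "\<lambda>s. (c + M) - M * (s - b)"])
          (auto intro!: derivative_eq_intros simp: field_simps)
      have \<Phi>b: "has_laplacian (\<lambda>s. \<Phi> (a, s)) b (- M)"
        unfolding \<Phi>_def
        by (rule has_laplacian_real[where w' = "\<lambda>s. - (c + M) + M * (a - s)"])
          (auto intro!: derivative_eq_intros simp: field_simps)
      have "has_laplacian (\<lambda>x. w (x, q)) x (0 - (l1 - l2))"
        unfolding w_def q fst_conv snd_conv
        by (intro has_laplacian_diff has_laplacian_const 1(2) 2(2))
      moreover have "has_laplacian (\<lambda>s. w (x, (s, b))) a (- M - (m1 - 0))"
        unfolding w_def fst_conv snd_conv
        by (intro has_laplacian_diff has_laplacian_const 1(3) \<Phi>a)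
      moreover have "has_laplacian (\<lambda>s. w (x, (a, s))) b (- M - (0 - m2))"
        unfolding w_def fst_conv snd_conv
        by (intro has_laplacian_diff has_laplacian_const 2(3) \<Phi>b)
      ultimately have "has_laplacian w (x, q) ((0 - (l1 - l2)) + ((- M - (m1 - 0)) + (- M - (0 - m2))))"
        unfolding q by (intro has_laplacian_prodI)
      moreover have "(0 - (l1 - l2)) + ((- M - (m1 - 0)) + (- M - (0 - m2))) \<le> 0"
        using 1(1) 2(1) f_bounds[OF range[of a x]] f_bounds[OF range[of b x]] ab by simp
      ultimately show ?thesis by auto
    qed
  qed auto
  then have "u (x, a) - u (x, b) \<le> \<Phi> (a, b)" by (simp add: w_def)
  also have "\<dots> \<le> (c + M) * (a - b)" using M by (simp add: \<Phi>_def)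
  finally show ?thesis .
qed

section \<open>Sliding\<close>

text \<open>
  Since \<open>f 0 \<ge> 0\<close>, the Lipschitz bound gives \<open>f (u) \<ge> - L u\<close>, that is \<open>\<Delta> u \<le> L u\<close>. So the
  exponential minorant carries the boundary value \<open>c\<close> of the upper face down into the slab.
\<close>
lemma uniformly_positive_on_slices:
  assumes f0: "0 \<le> f 0" and t: "0 < t" "t \<le> 1"
  shows "\<exists>\<eta>>0. \<forall>x. \<eta> \<le> u (x, t)"
proof -
  define A where "A = c / (exp (L + 1) - 1)"
  have e: "exp (L + 1) > (1::real)" using L_nonneg by simp
  then have A: "A > 0" using c_pos by (simp add: A_def)
  have "A * (exp ((L + 1) * (t - 0)) - 1) \<le> u (x, t)" for x
  proof (rule exponential_minorant[where \<alpha> = 0 and \<beta> = 1 and L = L])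
    show "\<exists>l. has_laplacian u (x, t) l \<and> l \<le> L * u (x, t)" if "0 < t" "t < 1" for x t
      using lap[of t x] f_bounds(3)[OF range[of t x]] f0 that by force
    show "0 \<le> u (x, t)" if "t \<in> {0..1}" for x t using range[OF that, of x] by simp
    show "A * (exp ((L + 1) * (1 - 0)) - 1) \<le> u (x, 1)" for x using e by (simp add: A_def top)
  qed (use A t cont bottom L_nonneg sq_dominates in auto)
  moreover have "0 < A * (exp ((L + 1) * (t - 0)) - 1)"
    using A t L_nonneg by (simp add: mult_pos_pos)
  ultimately show ?thesis by blast
qed

text \<open>
  The translate of \<open>u\<close> by the vector \<open>(y - x, s)\<close> lies above \<open>u\<close>, for every horizontal component
  \<open>y - x\<close>. Keeping that component arbitrary is what yields independence of \<open>x\<close> at \<open>s = 0\<close>.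
\<close>
definition slides :: "real \<Rightarrow> bool" where
  "slides s \<longleftrightarrow> (\<forall>x y t. 0 \<le> t \<longrightarrow> t + s \<le> 1 \<longrightarrow> u (x, t) \<le> u (y, t + s))"

text \<open>
  Both differential inequalities used for \<open>w\<close>, the difference of the translate and \<open>u\<close>, come from
  \<open>\<Delta> w \<le> L * \<bar>w\<bar>\<close>: it reads \<open>\<Delta> w \<le> L w\<close> where \<open>w \<ge> 0\<close> and \<open>\<Delta> w \<le> - L w\<close> where \<open>w < 0\<close>.
\<close>
lemma slid_difference:
  assumes s: "0 \<le> s"
  shows "continuous_on (UNIV \<times> {0..1 - s}) (\<lambda>p. u (p + (\<xi>, s)) - u p)"
    and "0 < t \<Longrightarrow> t < 1 - s \<Longrightarrow>
      has_laplacian (\<lambda>p. u (p + (\<xi>, s)) - u p) (x, t) (f (u (x, t)) - f (u ((x, t) + (\<xi>, s))))"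
    and "t \<in> {0..1 - s} \<Longrightarrow>
      f (u (x, t)) - f (u ((x, t) + (\<xi>, s))) \<le> L * \<bar>u ((x, t) + (\<xi>, s)) - u (x, t)\<bar>"
    and "t \<in> {0..1 - s} \<Longrightarrow> - c \<le> u ((x, t) + (\<xi>, s)) - u (x, t)"
proof -
  have "continuous_on (UNIV \<times> {0..1 - s}) (\<lambda>p. u (p + (\<xi>, s)))"
    by (rule continuous_on_compose2[OF cont]) (use s in \<open>auto intro!: continuous_intros\<close>)
  moreover have "continuous_on (UNIV \<times> {0..1 - s}) u"
    by (rule continuous_on_subset[OF cont]) (use s in auto)
  ultimately show "continuous_on (UNIV \<times> {0..1 - s}) (\<lambda>p. u (p + (\<xi>, s)) - u p)"
    by (rule continuous_on_diff)
  show "has_laplacian (\<lambda>p. u (p + (\<xi>, s)) - u p) (x, t) (f (u (x, t)) - f (u ((x, t) + (\<xi>, s))))"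
    if "0 < t" "t < 1 - s"
  proof -
    have "has_laplacian (\<lambda>p. u (p + (\<xi>, s)) - u p) (x, t) (- f (u ((x, t) + (\<xi>, s))) - (- f (u (x, t))))"
      using that s lap[of "t + s" "x + \<xi>"]
      by (intro has_laplacian_diff has_laplacian_translate lap) auto
    then show ?thesis by (simp add: algebra_simps)
  qed
  assume t: "t \<in> {0..1 - s}"
  then have r: "u (x, t) \<in> {0..c}" "u ((x, t) + (\<xi>, s)) \<in> {0..c}"
    using s range[of t x] range[of "t + s" "x + \<xi>"] by auto
  show "f (u (x, t)) - f (u ((x, t) + (\<xi>, s))) \<le> L * \<bar>u ((x, t) + (\<xi>, s)) - u (x, t)\<bar>"
    using lipschitz[OF r] by (simp add: abs_minus_commute)
  show "- c \<le> u ((x, t) + (\<xi>, s)) - u (x, t)" using r by simp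
qed

text \<open>
  Away from the upper face of the common slab the inequality is strict, uniformly: on the lower face
  \<open>u\<close> is zero and its translate at least \<open>\<eta>\<close>, and the difference satisfies
  \<open>\<Delta> w \<le> L w\<close>, so the exponential minorant applies. The bound degenerates at the upper face, where the translate
  is \<open>c\<close> and \<open>u\<close> may come arbitrarily close to \<open>c\<close>; hence the margin \<open>h\<close>.
\<close>
lemma slides_gap:
  assumes s0: "0 < s0" "s0 \<le> 1" "slides s0" and \<eta>: "0 < \<eta>" "\<And>x. \<eta> \<le> u (x, s0)" and h: "0 < h"
  shows "\<exists>\<kappa>>0. \<forall>x y t. 0 \<le> t \<longrightarrow> t \<le> 1 - s0 - h \<longrightarrow> \<kappa> \<le> u (y, t + s0) - u (x, t)"
proof (cases "s0 = 1")
  case True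
  \<comment> \<open>There is no \<open>t\<close> to consider.\<close>
  then show ?thesis using h by (intro exI[of _ 1]) auto
next
  case False
  define E where "E t = exp (- (L + 1) * (t - (1 - s0))) - 1" for t
  define A where "A = \<eta> / E 0"
  have E0: "E 0 > 0" using s0 False L_nonneg by (simp add: E_def mult_neg_neg)
  then have A: "A > 0" using \<eta> by (simp add: A_def)
  have AE0: "A * E 0 = \<eta>" using E0 by (simp add: A_def)
  have gap: "A * E t \<le> u ((x, t) + (\<xi>, s0)) - u (x, t)" if t: "t \<in> {0..1 - s0}" for x t \<xi>
    unfolding E_def
  proof (rule exponential_minorant[where w = "\<lambda>p. u (p + (\<xi>, s0)) - u p" and \<alpha> = 0
        and \<beta> = "1 - s0" and L = L])
    show *: "0 \<le> u ((x, t) + (\<xi>, s0)) - u (x, t)" if "t \<in> {0..1 - s0}" for x t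
      using s0(3) that unfolding slides_def by simp
    show "\<exists>l. has_laplacian (\<lambda>p. u (p + (\<xi>, s0)) - u p) (x, t) l \<and>
        l \<le> L * (u ((x, t) + (\<xi>, s0)) - u (x, t))" if "0 < t" "t < 1 - s0" for x t
      using slid_difference(2)[of s0 t \<xi> x] slid_difference(3)[of s0 t x \<xi>] *[of t x] that s0 by force
    show "L \<le> (- (L + 1))\<^sup>2" unfolding power2_minus by (rule sq_dominates[OF L_nonneg])
    show "A * (exp (- (L + 1) * (0 - (1 - s0))) - 1) \<le> u ((x, 0) + (\<xi>, s0)) - u (x, 0)" for x
      unfolding AE0[unfolded E_def] using \<eta>(2)[of "x + \<xi>"] by (simp add: bottom)
    show "A * (exp (- (L + 1) * ((1 - s0) - (1 - s0))) - 1)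
        \<le> u ((x, 1 - s0) + (\<xi>, s0)) - u (x, 1 - s0)" for x
      using *[of "1 - s0" x] s0 by simp
  qed (use slid_difference(1)[of s0] s0 t A L_nonneg in auto)
  have "A * (exp ((L + 1) * h) - 1) \<le> u (y, t + s0) - u (x, t)" if t: "0 \<le> t" "t \<le> 1 - s0 - h" for x y t
  proof -
    have "(L + 1) * h \<le> (L + 1) * (1 - s0 - t)" using t L_nonneg by (intro mult_left_mono) auto
    then have "(L + 1) * h \<le> - (L + 1) * (t - (1 - s0))" by (simp add: algebra_simps)
    then have "A * (exp ((L + 1) * h) - 1) \<le> A * E t" using A by (simp add: E_def)
    also have "\<dots> \<le> u (y, t + s0) - u (x, t)" using gap[of t x "y - x"] t h by simp
    finally show ?thesis .
  qed
  moreover have "A * (exp ((L + 1) * h) - 1) > 0" using A h L_nonneg by simp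
  ultimately show ?thesis by blast
qed

text \<open>
  Lowering \<open>s\<close> a little costs at most \<open>(c + M) * (s0 - s)\<close> by the Lipschitz bound, which the uniform
  gap absorbs below the margin of width \<open>h\<close>. In the margin itself there is no gap, but it is thin enough
  for the maximum principle with \<open>\<Lambda> = L\<close>: where \<open>w < 0\<close> the difference \<open>w\<close> satisfies
  \<open>\<Delta> w \<le> - L w\<close>.
\<close>
lemma slides_open:
  assumes s0: "0 < s0" "s0 \<le> 1" "slides s0" and \<eta>: "0 < \<eta>" "\<And>x. \<eta> \<le> u (x, s0)"
  shows "\<exists>e>0. \<forall>s. 0 \<le> s \<longrightarrow> s0 - e < s \<longrightarrow> s \<le> s0 \<longrightarrow> slides s"
proof -
  \<comment> \<open>The margin for \<open>s\<close> has width at most \<open>h + (s0 - s) \<le> 2 * h\<close>, whence the factor \<open>2\<close>.\<close>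
  define h where "h = 1 / (2 * (L + 1))"
  have h2: "(L + 1) * (2 * h) = 1" "0 < h" "2 * h \<le> 1"
    using L_nonneg by (simp_all add: h_def)
  have "(L + 1) * (2 * h)\<^sup>2 = (L + 1) * (2 * h) * (2 * h)"
    by (simp only: power2_eq_square mult.assoc)
  then have "(L + 1) * (2 * h)\<^sup>2 = 2 * h" by (simp only: h2(1) mult_1)
  then have h: "0 < h" "(max L 0 + 1) * (2 * h)\<^sup>2 \<le> 1"
    using h2 L_nonneg by simp_all
  obtain \<kappa> where \<kappa>: "\<kappa> > 0"
    "\<And>x y t. 0 \<le> t \<Longrightarrow> t \<le> 1 - s0 - h \<Longrightarrow> \<kappa> \<le> u (y, t + s0) - u (x, t)"
    using slides_gap[OF s0 \<eta> h(1)] by blast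
  have K: "0 < c + M" using c_pos f_bounds(4)[of 0] by simp
  define e where "e = min h (\<kappa> / (c + M))"
  have "slides s" if s: "0 \<le> s" "s0 - e < s" "s \<le> s0" for s
  proof -
    have low: "u (x, t) \<le> u (y, t + s)" if t: "0 \<le> t" "t \<le> 1 - s0 - h" for x y t
    proof -
      have "s0 - s \<le> \<kappa> / (c + M)" using s by (simp add: e_def)
      then have "(c + M) * (s0 - s) \<le> \<kappa>" using K by (simp add: pos_le_divide_eq mult.commute)
      moreover have "u (y, t + s0) - u (y, t + s) \<le> (c + M) * (s0 - s)"
        using vertical_lipschitz[of "t + s" "t + s0" y] t s h by simp
      ultimately show ?thesis using \<kappa>(2)[OF t, of y x] by linarith
    qed
    \<comment> \<open>When the maximum is \<open>0\<close>, the whole common slab is thin, and its lower face is \<open>t = 0\<close>, where \<open>u = 0\<close>.\<close>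
    define \<alpha> where "\<alpha> = max 0 (1 - s0 - h)"
    have high: "0 \<le> u ((x, t) + (\<xi>, s)) - u (x, t)" if t: "\<alpha> \<le> t" "t \<le> 1 - s" for x t \<xi>
    proof (rule slab_maximum_principle[where w = "\<lambda>p. u (p + (\<xi>, s)) - u p" and \<alpha> = \<alpha>
          and \<beta> = "1 - s" and r = "2 * h" and \<Lambda> = L and B = c])
      show "1 - s - \<alpha> \<le> 2 * h" using s by (auto simp: \<alpha>_def e_def)
      show "continuous_on (UNIV \<times> {\<alpha>..1 - s}) (\<lambda>p. u (p + (\<xi>, s)) - u p)"
        by (rule continuous_on_subset[OF slid_difference(1)[OF s(1)]]) (auto simp: \<alpha>_def)
      show "0 \<le> u ((x, \<alpha>) + (\<xi>, s)) - u (x, \<alpha>)" for x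
      proof (cases "1 - s0 - h \<ge> 0")
        case True
        then show ?thesis using low[of \<alpha> x "x + \<xi>"] by (simp add: \<alpha>_def)
      next
        case False
        then show ?thesis using range[of s "x + \<xi>"] s s0 by (simp add: \<alpha>_def bottom)
      qed
      show "0 \<le> u ((x, 1 - s) + (\<xi>, s)) - u (x, 1 - s)" for x
        using range[of "1 - s" x] s s0 by (simp add: top)
      show "- c \<le> u ((x, t) + (\<xi>, s)) - u (x, t)" if "t \<in> {\<alpha>..1 - s}" for x t
        using slid_difference(4)[OF s(1)] that by (simp add: \<alpha>_def)
      show "\<exists>l. has_laplacian (\<lambda>p. u (p + (\<xi>, s)) - u p) (x, t) l \<and>
          l \<le> - L * (u ((x, t) + (\<xi>, s)) - u (x, t))"
        if tt: "\<alpha> < t" "t < 1 - s" and neg: "u ((x, t) + (\<xi>, s)) - u (x, t) < 0" for x t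
      proof (intro exI conjI)
        have t0: "0 < t" using tt by (simp add: \<alpha>_def)
        show "has_laplacian (\<lambda>p. u (p + (\<xi>, s)) - u p) (x, t)
            (f (u (x, t)) - f (u ((x, t) + (\<xi>, s))))"
          by (rule slid_difference(2)[OF s(1) t0 tt(2)])
        have "f (u (x, t)) - f (u ((x, t) + (\<xi>, s))) \<le> L * \<bar>u ((x, t) + (\<xi>, s)) - u (x, t)\<bar>"
          using slid_difference(3)[OF s(1)] t0 tt by simp
        then show "f (u (x, t)) - f (u ((x, t) + (\<xi>, s))) \<le> - L * (u ((x, t) + (\<xi>, s)) - u (x, t))"
          unfolding abs_of_neg[OF neg] by (simp add: algebra_simps)
      qed
    qed (use h t in auto)
    show ?thesis
      unfolding slides_def
    proof (intro allI impI)
      fix x y t assume t: "0 \<le> t" "t + s \<le> 1"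
      show "u (x, t) \<le> u (y, t + s)"
      proof (cases "t \<le> 1 - s0 - h")
        case True
        then show ?thesis using low t by simp
      next
        case False
        then show ?thesis using high[of t x "y - x"] t by (simp add: \<alpha>_def)
      qed
    qed
  qed
  moreover have "e > 0" using h \<kappa>(1) K by (simp add: e_def)
  ultimately show ?thesis by blast
qed

lemma slides_closed:
  assumes s0: "0 \<le> s0" "s0 < 1" and above: "\<And>s. s0 < s \<Longrightarrow> s \<le> 1 \<Longrightarrow> slides s"
  shows "slides s0"
  unfolding slides_def
proof (intro allI impI)
  fix x y t assume t: "0 \<le> t" "t + s0 \<le> 1"
  have K: "0 < c + M" using c_pos f_bounds(4)[of 0] by simp
  show "u (x, t) \<le> u (y, t + s0)"
  proof (cases "t + s0 = 1")
    case True
    then show ?thesis using range[of t x] t s0 by (simp add: top)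
  next
    case False
    show ?thesis
    proof (rule field_le_epsilon)
      fix e :: real assume e: "0 < e"
      define d where "d = min (e / (c + M)) (1 - t - s0)"
      have d: "0 < d" "d \<le> 1 - t - s0" using e K t False by (auto simp: d_def)
      have "d \<le> e / (c + M)" by (simp add: d_def)
      then have "(c + M) * d \<le> e" using K by (simp add: pos_le_divide_eq mult.commute)
      moreover have "u (x, t) \<le> u (y, t + (s0 + d))"
        using above[of "s0 + d"] d t unfolding slides_def by auto
      moreover have "u (y, t + (s0 + d)) - u (y, t + s0) \<le> (c + M) * d"
        using vertical_lipschitz[of "t + s0" "t + (s0 + d)" y] d t s0 by simp
      ultimately show "u (x, t) \<le> u (y, t + s0) + e" by linarith
    qed
  qed
qed

text \<open>
  Continuous induction downwards from \<open>s = 1\<close>, where the two slabs only share a face.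
\<close>
lemma slides_all:
  assumes pos: "\<And>s. 0 < s \<Longrightarrow> s \<le> 1 \<Longrightarrow> \<exists>\<eta>>0. \<forall>x. \<eta> \<le> u (x, s)" and s: "0 \<le> s" "s \<le> 1"
  shows "slides s"
proof -
  define S where "S = {s \<in> {0..1}. \<forall>s'. s \<le> s' \<longrightarrow> s' \<le> 1 \<longrightarrow> slides s'}"
  define s0 where "s0 = Inf S"
  have one: "slides 1" using bottom top c_pos by (auto simp: slides_def)
  then have S1: "1 \<in> S" by (auto simp: S_def)
  have bdd: "bdd_below S" by (auto simp: S_def bdd_below_def)
  have "0 \<le> s0" unfolding s0_def using S1 by (intro cInf_greatest) (auto simp: S_def)
  moreover have "s0 \<le> 1" unfolding s0_def by (rule cInf_lower[OF S1 bdd])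
  ultimately have s01: "0 \<le> s0" "s0 \<le> 1" by auto
  have above: "slides s" if s: "s0 < s" "s \<le> 1" for s
  proof -
    obtain s' where "s' \<in> S" "s' < s"
      using cInf_less_iff[OF _ bdd, of s] S1 s(1) by (auto simp: s0_def)
    then show ?thesis using s(2) by (auto simp: S_def)
  qed
  have at: "slides s0" using slides_closed[OF s01(1) _ above] one s01(2) by (cases "s0 = 1") auto
  have "s0 = 0"
  proof (rule ccontr)
    assume "s0 \<noteq> 0"
    then have s0: "0 < s0" using s01 by simp
    obtain \<eta> where \<eta>: "0 < \<eta>" "\<And>x. \<eta> \<le> u (x, s0)" using pos[OF s0 s01(2)] by blast
    obtain e where e: "e > 0" "\<And>s. 0 \<le> s \<Longrightarrow> s0 - e < s \<Longrightarrow> s \<le> s0 \<Longrightarrow> slides s"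
      using slides_open[OF s0 s01(2) at \<eta>] by blast
    define r where "r = max 0 (s0 - e / 2)"
    have r: "0 \<le> r" "s0 - e < r" "r < s0" using e s0 by (auto simp: r_def)
    have "slides s'" if "r \<le> s'" "s' \<le> 1" for s'
      using e(2)[of s'] above[of s'] that r by (cases "s' \<le> s0") auto
    then have "r \<in> S" using r s01 by (auto simp: S_def)
    then have "s0 \<le> r" unfolding s0_def by (rule cInf_lower[OF _ bdd])
    then show False using r by simp
  qed
  then show ?thesis using at above[of s] s by (cases "s = 0") auto
qed

text \<open>
  The case \<open>s = 0\<close> of sliding compares \<open>u\<close> with all its horizontal translates, in both directions, hence
  gives equality; the cases \<open>s > 0\<close> give monotonicity. The horizontal part of the Laplacian then vanishes.
\<close>
lemma one_dimensional:
  assumes pos: "\<And>s. 0 < s \<Longrightarrow> s \<le> 1 \<Longrightarrow> \<exists>\<eta>>0. \<forall>x. \<eta> \<le> u (x, s)"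
  shows "t \<in> {0..1} \<Longrightarrow> u (x, t) = u (y, t)"
    and "0 \<le> s \<Longrightarrow> s \<le> t \<Longrightarrow> t \<le> 1 \<Longrightarrow> u (x, s) \<le> u (x, t)"
    and "0 < t \<Longrightarrow> t < 1 \<Longrightarrow> has_second_deriv (\<lambda>s. u (x, t + s)) (- f (u (x, t)))"
proof -
  have eq: "u (x, t) = u (y, t)" if "t \<in> {0..1}" for x y t
    using slides_all[OF pos, of 0] that by (auto simp: slides_def intro: antisym)
  then show "t \<in> {0..1} \<Longrightarrow> u (x, t) = u (y, t)" .
  show "u (x, s) \<le> u (x, t)" if "0 \<le> s" "s \<le> t" "t \<le> 1"
  proof -
    have "slides (t - s)" using slides_all[OF pos] that by simp
    then have "0 \<le> s \<longrightarrow> s + (t - s) \<le> 1 \<longrightarrow> u (x, s) \<le> u (x, s + (t - s))"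
      unfolding slides_def by blast
    then show ?thesis using that by simp
  qed
  assume t: "0 < t" "t < 1"
  obtain l m where lm: "- f (u (x, t)) = l + m" "has_laplacian (\<lambda>x. u (x, t)) x l"
    "has_laplacian (\<lambda>t. u (x, t)) t m" using has_laplacian_prodE[OF lap[OF t, of x]] .
  have "(\<lambda>x'. u (x', t)) = (\<lambda>_. u (x, t))"
    by (rule ext, rule eq) (use t in simp)
  then have "has_laplacian (\<lambda>_. u (x, t)) x l" using lm(2) by (simp only:)
  then have "l = 0" by (rule has_laplacian_const_unique)
  then show "has_second_deriv (\<lambda>s. u (x, t + s)) (- f (u (x, t)))"
    using lm by (simp add: has_laplacian_real_iff)
qed

end

section \<open>Monotone one-dimensional solutions\<close>

text \<open>
  If \<open>deriv v t = 0\<close>, then \<open>s \<mapsto> v (t + s)\<close> and \<open>s \<mapsto> v (t - s)\<close> solve the same Cauchy problem, so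
  by uniqueness \<open>v\<close> is symmetric about \<open>t\<close>. Taking \<open>s\<close> to be the distance from \<open>t\<close> to the nearer end of
  the interval, \<open>v\<close> takes an end value at an interior point or equal values at both ends, which is excluded.
  Uniqueness is proved by the energy estimate that gives Gronwall's inequality: \<open>E\<close> below is
  nonincreasing and starts at \<open>0\<close>.
\<close>
lemma monotone_profile_deriv_pos:
  fixes v :: "real \<Rightarrow> real"
  assumes mono: "\<And>s t. 0 \<le> s \<Longrightarrow> s \<le> t \<Longrightarrow> t \<le> 1 \<Longrightarrow> v s \<le> v t"
    and cont: "continuous_on {0..1} v"
    and ode: "\<And>t. 0 < t \<Longrightarrow> t < 1 \<Longrightarrow> has_second_deriv (\<lambda>s. v (t + s)) (- f (v t))"
    and lipschitz: "\<And>a b. a \<in> {v 0..v 1} \<Longrightarrow> b \<in> {v 0..v 1} \<Longrightarrow> \<bar>f a - f b\<bar> \<le> L * \<bar>a - b\<bar>"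
    and inner: "\<And>t. 0 < t \<Longrightarrow> t < 1 \<Longrightarrow> v 0 < v t \<and> v t < v 1"
    and t: "0 < t" "t < 1"
  shows "(v has_real_derivative deriv v t) (at t)" "0 < deriv v t"
proof -
  have d: "(v has_real_derivative deriv v s) (at s)" "(deriv v has_real_derivative - f (v s)) (at s)"
    if "0 < s" "s < 1" for s
    by (rule has_second_deriv_shift_imp_deriv[where v = v and t = s, OF ode[OF that]])+
  show "(v has_real_derivative deriv v t) (at t)" by (rule d(1)[OF t])
  have "0 \<le> deriv v t"
  proof (rule ccontr)
    assume "\<not> 0 \<le> deriv v t"
    then obtain e where e: "e > 0" "\<And>h. 0 < h \<Longrightarrow> h < e \<Longrightarrow> v (t + h) < v t"
      using has_real_derivative_neg_dec_right[OF d(1)[OF t]] by auto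
    define h where "h = min e (1 - t) / 2"
    have "0 < h" "h < e" "h < 1 - t" using e(1) t by (auto simp: h_def)
    then show False using e(2)[of h] mono[of t "t + h"] t by simp
  qed
  moreover have "deriv v t \<noteq> 0"
  proof
    assume v0: "deriv v t = 0"
    define \<rho> where "\<rho> = min t (1 - t)"
    have \<rho>: "0 < \<rho>" "\<rho> \<le> t" "\<rho> \<le> 1 - t" using t by (auto simp: \<rho>_def)
    define z where "z s = v (t + s) - v (t - s)" for s
    define z' where "z' s = deriv v (t + s) + deriv v (t - s)" for s
    define E where "E s = exp (- (1 + L) * s) * ((z s)\<^sup>2 + (z' s)\<^sup>2)" for s
    have zero: "z s = 0" if s: "s \<in> {0..<\<rho>}" for s
    proof -
      have "E s \<le> E 0"
      proof (rule DERIV_nonpos_imp_nonincreasing[where f = E])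
        show "0 \<le> s" using s by simp
        fix r assume r: "0 \<le> r" "r \<le> s"
        have in01: "0 < t + r" "t + r < 1" "0 < t - r" "t - r < 1" using r s \<rho> by auto
        have plus: "((\<lambda>r. g (t + r)) has_real_derivative g') (at r)"
          if "(g has_real_derivative g') (at (t + r))" for g g'
          using that DERIV_shift[of g g' r t] by (simp add: add.commute)
        have minus: "((\<lambda>r. g (t - r)) has_real_derivative - g') (at r)"
          if "(g has_real_derivative g') (at (t - r))" for g g'
        proof -
          have "((\<lambda>r. t - r) has_real_derivative - 1) (at r)"
            by (auto intro!: derivative_eq_intros)
          then show ?thesis using DERIV_chain2[of g g' "\<lambda>r. t - r" r "- 1", OF that] by simp
        qed
        have dz: "(z has_real_derivative z' r) (at r)"
          unfolding z_def z'_def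
          using DERIV_diff[OF plus[OF d(1)] minus[OF d(1)]] in01 by simp
        define \<Delta> where "\<Delta> = f (v (t - r)) - f (v (t + r))"
        have dz': "(z' has_real_derivative \<Delta>) (at r)"
          unfolding z'_def \<Delta>_def
          using DERIV_add[OF plus[OF d(2)] minus[OF d(2)]] in01 by (simp add: algebra_simps)
        have dE: "(E has_real_derivative exp (- (1 + L) * r) *
            (2 * z r * z' r + 2 * z' r * \<Delta> - (1 + L) * ((z r)\<^sup>2 + (z' r)\<^sup>2))) (at r)"
          unfolding E_def
          by (auto intro!: derivative_eq_intros dz dz' simp: algebra_simps)
        have "\<bar>\<Delta>\<bar> \<le> L * \<bar>z r\<bar>"
          using lipschitz[of "v (t - r)" "v (t + r)"] inner[of "t - r"] inner[of "t + r"] in01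
          by (auto simp: \<Delta>_def z_def abs_minus_commute)
        then have "2 * \<bar>z' r\<bar> * \<bar>\<Delta>\<bar> \<le> 2 * \<bar>z' r\<bar> * (L * \<bar>z r\<bar>)"
          by (intro mult_left_mono) auto
        moreover have "2 * z' r * \<Delta> \<le> 2 * \<bar>z' r\<bar> * \<bar>\<Delta>\<bar>"
          using abs_ge_self[of "2 * z' r * \<Delta>"] by (simp add: abs_mult)
        moreover have "2 * z r * z' r \<le> (z r)\<^sup>2 + (z' r)\<^sup>2" by (rule sum_squares_bound)
        moreover have "v 0 < v 1" using inner[of t] t by simp
        then have "0 \<le> L * \<bar>v 0 - v 1\<bar>" "0 < \<bar>v 0 - v 1\<bar>"
          using lipschitz[of "v 0" "v 1"] by auto
        then have "0 \<le> L" by (simp add: zero_le_mult_iff)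
        then have "L * (2 * \<bar>z' r\<bar> * \<bar>z r\<bar>) \<le> L * ((z r)\<^sup>2 + (z' r)\<^sup>2)"
          using sum_squares_bound[of "\<bar>z' r\<bar>" "\<bar>z r\<bar>"] by (intro mult_left_mono) auto
        ultimately have "2 * z r * z' r + 2 * z' r * \<Delta> - (1 + L) * ((z r)\<^sup>2 + (z' r)\<^sup>2) \<le> 0"
          by (simp add: algebra_simps)
        then show "\<exists>y. (E has_real_derivative y) (at r) \<and> y \<le> 0"
          using dE by (intro exI conjI) (auto simp: mult_le_0_iff)
      qed
      also have "E 0 = 0" using v0 by (simp add: E_def z_def z'_def)
      finally have "(z s)\<^sup>2 + (z' s)\<^sup>2 \<le> 0" by (simp add: E_def mult_le_0_iff)
      then show ?thesis by (simp add: sum_power2_le_zero_iff)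
    qed
    have "continuous_on {0..\<rho>} z"
      unfolding z_def by (intro continuous_intros continuous_on_compose2[OF cont]) (use \<rho> t in auto)
    then have "z \<rho> = 0"
      using continuous_constant_on_closure[of "{0..<\<rho>}" z 0 \<rho>] zero \<rho>
      by (simp add: closure_atLeastLessThan)
    then have eq: "v (t + \<rho>) = v (t - \<rho>)" by (simp add: z_def)
    show False
    proof (cases "t \<le> 1 - t")
      case True
      then have "\<rho> = t" by (simp add: \<rho>_def)
      then show ?thesis using eq inner[of t] mono[of t "t + t"] t True by simp
    next
      case False
      then have "\<rho> = 1 - t" by (simp add: \<rho>_def)
      then show ?thesis using eq inner[of t] mono[of "t - (1 - t)" t] t False by simp
    qed
  qed
  ultimately show "0 < deriv v t" by simp
qed

section \<open>One-dimensional symmetry in the slab\<close>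

theorem proposition1p8:
  fixes f :: "real \<Rightarrow> real"
    and u :: "(real ^ 'm) \<times> real \<Rightarrow> real"
    and c :: real
  assumes f_lipschitz: "local_lipschitz (UNIV :: real set) UNIV (\<lambda>_. f)"
    and u_C2: "C2_closure slab u"
    and u_bounded: "bounded (u ` closure slab)"
    and equation: "\<forall>x\<in>slab. laplacian u x + f (u x) = 0"
    and c_pos: "c > 0"
    and bottom: "\<forall>x'. u (x', 0) = 0"
    and top: "\<forall>x'. u (x', 1) = c"
    and between: "\<forall>x\<in>slab. 0 < u x \<and> u x < c"
    and alternatives:
      "(\<forall>t. 0 < t \<and> t < 1 \<longrightarrow>
          0 < (INF x'. u (x', t)) \<and>
          (INF x'. u (x', t)) \<le> (SUP x'. u (x', t)) \<and>
          (SUP x'. u (x', t)) < c)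
       \<or> (f c \<le> 0 \<and> 0 \<le> f 0)"
  shows "\<exists>v :: real \<Rightarrow> real.
           (\<forall>x\<in>closure slab. u x = v (snd x)) \<and>
           (\<forall>t. 0 < t \<and> t < 1 \<longrightarrow> (\<exists>d>0. (v has_real_derivative d) (at t)))"
proof -
  have closure: "closure slab = (UNIV :: (real ^ 'm) set) \<times> {0..1::real}"
    by (simp add: slab_def closure_Times)
  have inner: "0 < u (x, t)" "u (x, t) < c" if "0 < t" "t < 1" for x t
    using between that by (auto simp: slab_def)
  obtain L where L: "L-lipschitz_on {0..c} f"
    using local_lipschitz_compact_implies_lipschitz[where X = "{0..c}" and T = "{0::real}" and f = "\<lambda>_. f"]
      local_lipschitz_subset[OF f_lipschitz, of "{0}" "{0..c}"] by auto
  interpret slab_solution f u c L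
  proof
    show "0 \<le> L" using L by (rule lipschitz_on_nonneg)
    show "\<bar>f a - f b\<bar> \<le> L * \<bar>a - b\<bar>" if "a \<in> {0..c}" "b \<in> {0..c}" for a b
      using lipschitz_onD[OF L that] by (simp add: dist_real_def)
    show "continuous_on (UNIV \<times> {0..1}) u" using u_C2 by (simp add: C2_closure_def closure)
    show "u (x, t) \<in> {0..c}" if "t \<in> {0..1}" for x t
      using inner[of t x] that bottom top c_pos by (cases "t = 0"; cases "t = 1") auto
    show "has_laplacian u (x, t) (- f (u (x, t)))" if t: "0 < t" "t < 1" for x t
    proof -
      have xt: "(x, t) \<in> slab" using t by (simp add: slab_def)
      have "open (slab :: ((real ^ 'm) \<times> real) set)" by (simp add: slab_def open_Times)
      then have "has_laplacian u (x, t) (laplacian u (x, t))"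
        using C2_closure_has_laplacian[OF u_C2 _ xt] by simp
      moreover have "laplacian u (x, t) = - f (u (x, t))" using equation xt by fastforce
      ultimately show ?thesis by simp
    qed
  qed (use c_pos bottom top in auto)
  \<comment> \<open>Sliding needs a positive lower bound on each slice; either alternative provides it.\<close>
  have pos: "\<exists>\<eta>>0. \<forall>x. \<eta> \<le> u (x, s)" if s: "0 < s" "s \<le> 1" for s
  proof (cases "s = 1")
    case True
    then show ?thesis using c_pos top by auto
  next
    case False
    show ?thesis
      using alternatives
    proof
      assume "\<forall>t. 0 < t \<and> t < 1 \<longrightarrow> 0 < (INF x'. u (x', t)) \<and>
          (INF x'. u (x', t)) \<le> (SUP x'. u (x', t)) \<and> (SUP x'. u (x', t)) < c"
      then have "0 < (INF x'. u (x', s))" using s False by simp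
      moreover have "bdd_below (range (\<lambda>x'. u (x', s)))"
        using inner(1)[of s] s False by (intro bdd_belowI[of _ 0]) (auto simp: less_imp_le)
      then have "(INF x'. u (x', s)) \<le> u (x, s)" for x by (rule cINF_lower) simp
      ultimately show ?thesis by blast
    next
      assume "f c \<le> 0 \<and> 0 \<le> f 0"
      then show ?thesis using uniformly_positive_on_slices s by simp
    qed
  qed
  define v where "v t = u (0, t)" for t
  have "(v has_real_derivative deriv v t) (at t)" "0 < deriv v t" if t: "0 < t" "t < 1" for t
  proof -
    have "continuous_on {0..1} v"
      unfolding v_def by (rule continuous_on_compose2[OF cont]) (auto intro!: continuous_intros)
    moreover have "v 0 = 0" "v 1 = c" using bottom top by (auto simp: v_def)
    ultimately show "(v has_real_derivative deriv v t) (at t)" "0 < deriv v t"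
      using monotone_profile_deriv_pos[of v f L t] one_dimensional(2,3)[OF pos] lipschitz inner t
      by (simp_all add: v_def)
  qed
  moreover have "\<forall>x\<in>closure slab. u x = v (snd x)"
    using one_dimensional(1)[OF pos] by (auto simp: closure v_def)
  ultimately show ?thesis by blast
qed

end
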